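(* Let $\alpha$ be a regular curve in $\mathbb{S}^{m+1}(r)$ or $\mathbb{H}^{m+1}(r)$, and let $\kappa_1,\dots,\kappa_m$ be its curvatures with respect to a rotation minimizing frame. Then $\alpha$ lies on a geodesic sphere if and only if $$\sum_{i=1}^m a_i\,\kappa_i+\frac1r\cot\Big(\frac{z_0}{r}\Big)=0\ \text{ if }\alpha\subseteq\mathbb{S}^{m+1}(r),\qquad \sum_{i=1}^m a_i\,\kappa_i+\frac1r\coth\Big(\frac{z_0}{r}\Big)=0\ \text{ if }\alpha\subseteq\mathbb{H}^{m+1}(r),$$ for some constants $z_0<\pi r/2$ (the radius of the geodesic sphere) and $a_i$, $1\le i\le m$.
   Context: $\mathbb{S}^{m+1}(r)=\{q\in\mathbb{R}^{m+2}:\langle q,q\rangle_e=r^2\}$ with the metric induced by the Euclidean inner product $\langle\cdot,\cdot\rangle_e$, and $\mathbb{H}^{m+1}(r)=\{q\in\mathbb{R}^{m+2}:\langle q,q\rangle_1=-r^2,\ q_1>0\}$ with the metric induced by $\langle x,y\rangle_1=-x_1y_1+\sum_{i=2}^{m+2}x_iy_i$. $\nabla$ denotes the Levi-Civita connection. Curves are parametrized by arc-length. A rotation minimizing frame along $\alpha$ is an orthonormal frame $\{\mathbf t,\mathbf n_1,\dots,\mathbf n_m\}$ of tangent vectors to the ambient manifold along $\alpha$ with $\mathbf t=\alpha'$ and $\nabla_{\mathbf t}\mathbf n_i=-\kappa_i\mathbf t$; then $\nabla_{\mathbf t}\mathbf t=\sum_i\kappa_i\mathbf n_i$. A geodesic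 sphere of radius $z_0$ and center $p$ is the set of points at geodesic distance $z_0$ from $p$. The restriction $z_0<\pi r/2$ guarantees that the center of the geodesic sphere is well defined: in $\mathbb{S}^{m+1}(r)$, if $z_0=\pi r/2$, both $p$ and its antipodal point $-p$ are equidistant from the geodesic sphere.
   Formalization: In the hyperbolic case the constants are normalized by Σ a_i² = 1 (without this, curves of constant curvature 0<κ_1<1/r refute the "if" part) and z_0 ranges over all positive radii, not only z_0<πr/2; radii are taken positive in both cases. *)

theory Defs
  imports "HOL-Analysis.Analysis"
begin

text \<open>
  For a finite index type \<open>'m\<close> with \<open>m\<close> elements (hence \<open>m \<ge> 1\<close>), the space of
  dimension \<open>m + 2\<close> is \<open>real ^ 'm option option\<close>; the coordinate \<open>None\<close> is the
  first coordinate. The Riemannian sphere of radius \<open>r\<close> is the library's \<open>sphere 0 r\<close>.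
\<close>

definition lorentz :: "real ^ 'k::finite option \<Rightarrow> real ^ 'k option \<Rightarrow> real" where
  "lorentz x y = - (x $ None * y $ None) + (\<Sum>i\<in>UNIV - {None}. x $ i * y $ i)"

definition hyperbolic_space :: "real \<Rightarrow> (real ^ 'k::finite option) set" where
  "hyperbolic_space r = {q. lorentz q q = - r\<^sup>2 \<and> q $ None > 0}"

definition coth :: "real \<Rightarrow> real" where
  "coth x = cosh x / sinh x"


text \<open>
  Both model spaces are (components of) quadrics \<open>g q q = const \<noteq> 0\<close> for a nondegenerate
  symmetric bilinear form \<open>g\<close>, with the metric induced by \<open>g\<close>; the following notions
  take \<open>g\<close> as a parameter. The tangent space is the kernel of the differential of
  \<open>q \<mapsto> g q q\<close>.
\<close>

definition tangent_space :: "('v::real_normed_vector \<Rightarrow> 'v \<Rightarrow> real) \<Rightarrow> 'v \<Rightarrow> 'v set" where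
  "tangent_space g q = {v. g q v = 0}"

definition tangential_part :: "('v::real_normed_vector \<Rightarrow> 'v \<Rightarrow> real) \<Rightarrow> 'v \<Rightarrow> 'v \<Rightarrow> 'v" where
  "tangential_part g q v = v - (g q v / g q q) *\<^sub>R q"

abbreviation velocity :: "(real \<Rightarrow> 'v::real_normed_vector) \<Rightarrow> real \<Rightarrow> 'v" where
  "velocity \<gamma> s \<equiv> vector_derivative \<gamma> (at s)"

text \<open>
  The Levi-Civita connection of a nondegenerate submanifold of a flat space is the tangential
  part of the flat one; this is the resulting covariant derivative of a vector field \<open>X\<close>
  along a curve \<open>\<alpha>\<close>.
\<close>

definition covariant_derivative ::
  "('v::real_normed_vector \<Rightarrow> 'v \<Rightarrow> real) \<Rightarrow> (real \<Rightarrow> 'v) \<Rightarrow> (real \<Rightarrow> 'v) \<Rightarrow> real \<Rightarrow> 'v" where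
  "covariant_derivative g \<alpha> X s = tangential_part g (\<alpha> s) (velocity X s)"

definition arclength_curve ::
  "('v::real_normed_vector \<Rightarrow> 'v \<Rightarrow> real) \<Rightarrow> 'v set \<Rightarrow> real set \<Rightarrow> (real \<Rightarrow> 'v) \<Rightarrow> bool" where
  "arclength_curve g M I \<alpha> \<longleftrightarrow>
     open I \<and> is_interval I \<and> I \<noteq> {} \<and> \<alpha> ` I \<subseteq> M \<and>
     \<alpha> C1_differentiable_on I \<and> velocity \<alpha> C1_differentiable_on I \<and>
     (\<forall>s\<in>I. g (velocity \<alpha> s) (velocity \<alpha> s) = 1)"

definition rotation_minimizing_frame ::
  "('v::real_normed_vector \<Rightarrow> 'v \<Rightarrow> real) \<Rightarrow> real set \<Rightarrow> (real \<Rightarrow> 'v) \<Rightarrow>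
   ('m \<Rightarrow> real \<Rightarrow> 'v) \<Rightarrow> ('m \<Rightarrow> real \<Rightarrow> real) \<Rightarrow> bool" where
  "rotation_minimizing_frame g I \<alpha> n \<kappa> \<longleftrightarrow>
     (\<forall>i. n i C1_differentiable_on I) \<and>
     (\<forall>s\<in>I.
        velocity \<alpha> s \<in> tangent_space g (\<alpha> s) \<and>
        g (velocity \<alpha> s) (velocity \<alpha> s) = 1 \<and>
        (\<forall>i. n i s \<in> tangent_space g (\<alpha> s) \<and>
             g (velocity \<alpha> s) (n i s) = 0 \<and>
             (\<forall>j. g (n i s) (n j s) = (if i = j then 1 else 0)) \<and>
             covariant_derivative g \<alpha> (n i) s = - \<kappa> i s *\<^sub>R velocity \<alpha> s))"


text \<open>
  A \<open>valid_path\<close> is a continuous curve that is C1 off a finite set, which does not bound its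
  speed near the exceptional points. Integrability of the speed is therefore demanded
  separately: the integral of a non-integrable function is \<open>0\<close> by convention, so curves of
  infinite length would otherwise count as curves of length \<open>0\<close>.
\<close>

definition speed ::
  "('v::real_normed_vector \<Rightarrow> 'v \<Rightarrow> real) \<Rightarrow> (real \<Rightarrow> 'v) \<Rightarrow> real \<Rightarrow> real" where
  "speed g \<gamma> t = sqrt (g (velocity \<gamma> t) (velocity \<gamma> t))"

definition connecting_curves ::
  "('v::real_normed_vector \<Rightarrow> 'v \<Rightarrow> real) \<Rightarrow> 'v set \<Rightarrow> 'v \<Rightarrow> 'v \<Rightarrow> (real \<Rightarrow> 'v) set" where
  "connecting_curves g M p q =
     {\<gamma>. valid_path \<gamma> \<and> path_image \<gamma> \<subseteq> M \<and> pathstart \<gamma> = p \<and> pathfinish \<gamma> = q \<and>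
         speed g \<gamma> integrable_on {0..1}}"

definition geodesic_distance ::
  "('v::real_normed_vector \<Rightarrow> 'v \<Rightarrow> real) \<Rightarrow> 'v set \<Rightarrow> 'v \<Rightarrow> 'v \<Rightarrow> real" where
  "geodesic_distance g M p q = (INF \<gamma>\<in>connecting_curves g M p q. integral {0..1} (speed g \<gamma>))"

definition geodesic_sphere ::
  "('v::real_normed_vector \<Rightarrow> 'v \<Rightarrow> real) \<Rightarrow> 'v set \<Rightarrow> 'v \<Rightarrow> real \<Rightarrow> 'v set" where
  "geodesic_sphere g M p z = {q\<in>M. geodesic_distance g M p q = z}"


text \<open>
  The following two facts confirm that \<open>tangential_part\<close> is the \<open>g\<close>-orthogonal projection
  onto the tangent space and that the covariant derivative is compatible with the metric.
\<close>

lemma tangential_part_orthogonal_projection: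
  assumes "bounded_bilinear g" and "\<And>x y. g x y = g y x" and "g q q \<noteq> 0"
  shows "tangential_part g q v \<in> tangent_space g q"
    and "u \<in> tangent_space g q \<Longrightarrow> g (v - tangential_part g q v) u = 0"
proof -
  interpret bounded_bilinear g by fact
  show "tangential_part g q v \<in> tangent_space g q"
    using assms(3) by (simp add: tangential_part_def tangent_space_def diff_right scaleR_right)
  show "u \<in> tangent_space g q \<Longrightarrow> g (v - tangential_part g q v) u = 0"
    by (simp add: tangential_part_def tangent_space_def scaleR_left)
qed

lemma covariant_derivative_metric_compatible:
  assumes "bounded_bilinear g" and "\<And>x y. g x y = g y x"
    and "X differentiable (at s)" and "Y differentiable (at s)"
    and "X s \<in> tangent_space g (\<alpha> s)" and "Y s \<in> tangent_space g (\<alpha> s)"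
  shows "((\<lambda>u. g (X u) (Y u)) has_vector_derivative
           g (covariant_derivative g \<alpha> X s) (Y s) + g (X s) (covariant_derivative g \<alpha> Y s)) (at s)"
proof -
  interpret bounded_bilinear g by fact
  have "g (covariant_derivative g \<alpha> X s) (Y s) = g (velocity X s) (Y s)"
    using assms(6)
    by (simp add: covariant_derivative_def tangential_part_def tangent_space_def
        diff_left scaleR_left)
  moreover have "g (X s) (covariant_derivative g \<alpha> Y s) = g (X s) (velocity Y s)"
    using assms(2)[of "X s" "\<alpha> s"] assms(5)
    by (simp add: covariant_derivative_def tangential_part_def tangent_space_def
        diff_right scaleR_right)
  ultimately show ?thesis
    using has_vector_derivative[OF vector_derivative_works[THEN iffD1, OF assms(3)]
        vector_derivative_works[THEN iffD1, OF assms(4)]]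
    by (simp add: add.commute)
qed

lemma bounded_bilinear_lorentz:
  "bounded_bilinear (lorentz :: real ^ 'k::finite option \<Rightarrow> real ^ 'k option \<Rightarrow> real)"
  unfolding bilinear_conv_bounded_bilinear[symmetric] bilinear_def lorentz_def
  by (auto intro!: linearI simp: algebra_simps sum.distrib sum_distrib_left)

lemma lorentz_commute: "lorentz x y = lorentz y x"
  by (simp add: lorentz_def mult.commute)

end

theory Submission
  imports Defs
begin

text \<open>
  Both model spaces are quadrics \<open>g q q = \<epsilon> r\<^sup>2\<close> with \<open>\<epsilon> = 1\<close> for the sphere and \<open>\<epsilon> = -1\<close> for
  hyperbolic space, and the geodesic spheres of radius \<open>z\<close> about \<open>p\<close> are their sections by the affine
  hyperplanes \<open>g p q = \<epsilon> r\<^sup>2 C (z / r)\<close>, where \<open>C\<close> and \<open>S\<close> are \<open>cos\<close> and \<open>sin\<close>, or \<open>cosh\<close> and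
  \<open>sinh\<close>. Once this is known, the theorem is linear algebra along the curve \<open>\<alpha>\<close> with velocity \<open>T\<close>.

  In the ambient vector space, a rotation minimizing frame satisfies \<open>n\<^sub>i' = - \<kappa>\<^sub>i T\<close>: the normal
  component of the derivative vanishes since \<open>n\<^sub>i\<close> is orthogonal to \<open>\<alpha>\<close> and to \<open>T\<close>. If \<open>\<alpha>\<close> lies
  in the hyperplane determined by \<open>p\<close>, then differentiation gives \<open>g p T = 0\<close>, so each \<open>g p n\<^sub>i\<close> is a
  constant \<open>b\<^sub>i\<close> and the expansion of \<open>p\<close> in the orthogonal basis \<open>\<alpha>, T, n\<^sub>1, \<dots>, n\<^sub>m\<close> is
  \<open>p = C \<alpha> + \<Sum> b\<^sub>i n\<^sub>i\<close>. Its derivative is the relation \<open>\<Sum> b\<^sub>i \<kappa>\<^sub>i = C\<close>, and \<open>g p p = \<epsilon> r\<^sup>2\<close> gives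
  \<open>\<Sum> b\<^sub>i\<^sup>2 = r\<^sup>2 S\<^sup>2\<close>; so \<open>a\<^sub>i = - b\<^sub>i / (r S)\<close> are the coefficients wanted. Conversely, the relation
  says exactly that \<open>C \<alpha> - r S \<Sum> a\<^sub>i n\<^sub>i\<close> has derivative zero, and this constant vector is
  the center. Both directions are \<open>spherical_iff_curvature_relation\<close>.

  The analytic part is the geodesic distance, which is an infimum of lengths. Great circle arcs and
  their hyperbolic analogues attain the expected value (\<open>geodesic_arc\<close>). That no curve is shorter
  is a calibration argument (\<open>length_lower_bound\<close>): along a curve \<open>\<gamma>\<close> from \<open>p\<close>, the function
  \<open>f = g p \<gamma> / (\<epsilon> r\<^sup>2)\<close> satisfies \<open>r \<bar>f'\<bar> \<le> sqrt (\<epsilon> (1 - f\<^sup>2)) speed\<close> by the Cauchy-Schwarz inequality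
  in the tangent space. One would integrate the derivative of \<open>arccos f\<close> or \<open>arcosh f\<close>, but these
  functions are not differentiable where \<open>f\<^sup>2 = 1\<close>, for instance at the starting point. Replacing \<open>f\<close> by
  \<open>c f\<close>, with \<open>c < 1\<close> for the sphere and \<open>c > 1\<close> for hyperbolic space, removes the singularity and keeps
  the inequality; then \<open>c\<close> tends to \<open>1\<close>.

  On the sphere with variable radius the coefficients are arbitrary. Since \<open>cot\<close> takes every positive
  value on \<open>(0, \<pi>/2)\<close>, rescaling a relation to \<open>\<Sum> a\<^sub>i\<^sup>2 = 1\<close> only changes its radius
  (\<open>normalize_coefficients\<close>). On hyperbolic space this would fail, as \<open>coth > 1\<close>.
\<close>

section \<open>Orthogonal families for a bilinear form\<close>

text \<open>
  The form may be indefinite; orthogonality gives linear independence as soon as no member of the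
  family is null, since pairing a linear combination with a member isolates its coefficient.
\<close>

lemma orthogonal_family_expansion:
  fixes e :: "'k::finite \<Rightarrow> 'v::euclidean_space"
  assumes g: "bounded_bilinear g"
    and card: "CARD('k) = DIM('v)"
    and orth: "\<And>i j. i \<noteq> j \<Longrightarrow> g (e i) (e j) = (0::real)"
    and nonnull: "\<And>i. g (e i) (e i) \<noteq> 0"
  shows "x = (\<Sum>k\<in>UNIV. (g x (e k) / g (e k) (e k)) *\<^sub>R e k)"
proof -
  interpret bounded_bilinear g by fact
  have inj: "inj e"
    by (rule injI) (metis orth nonnull)
  have pair: "g (\<Sum>k\<in>UNIV. c k *\<^sub>R e k) (e j) = c j * g (e j) (e j)" for c j
  proof -
    have "g (\<Sum>k\<in>UNIV. c k *\<^sub>R e k) (e j) = (\<Sum>k\<in>UNIV. c k * g (e k) (e j))"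
      by (simp add: sum_left scaleR_left)
    also have "\<dots> = (\<Sum>k\<in>UNIV. if k = j then c j * g (e j) (e j) else 0)"
      by (rule sum.cong) (auto simp: orth)
    finally show ?thesis by simp
  qed
  have reindex: "(\<Sum>v\<in>range e. f v *\<^sub>R v) = (\<Sum>k\<in>UNIV. f (e k) *\<^sub>R e k)" for f
    using inj by (simp add: sum.reindex)
  have "independent (range e)"
  proof (rule independent_if_scalars_zero)
    fix f v assume "(\<Sum>v\<in>range e. f v *\<^sub>R v) = 0" "v \<in> range e"
    then obtain j where "v = e j" "(\<Sum>k\<in>UNIV. f (e k) *\<^sub>R e k) = 0"
      using reindex by auto
    with pair[of "\<lambda>k. f (e k)" j] nonnull show "f v = 0"
      by (simp add: zero_left)
  qed simp
  then have "UNIV \<subseteq> span (range e)"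
    by (rule card_ge_dim_independent[rotated]) (simp_all add: card_image inj card)
  then have "x \<in> range (\<lambda>f. \<Sum>v\<in>range e. f v *\<^sub>R v)"
    using span_finite[of "range e"] by auto
  then obtain f where "x = (\<Sum>k\<in>UNIV. f (e k) *\<^sub>R e k)"
    unfolding reindex by blast
  then show ?thesis
    using pair[of "\<lambda>k. f (e k)"] nonnull by simp
qed

lemma sum_option:
  fixes F :: "'k::finite option \<Rightarrow> 'b::comm_monoid_add"
  shows "(\<Sum>k\<in>UNIV. F k) = F None + (\<Sum>i\<in>UNIV. F (Some i))"
  by (simp add: UNIV_option_conv sum.reindex)

section \<open>The two model spaces as quadrics\<close>

text \<open>
  What the two geometries have in common. The assumption \<open>sheet\<close> recovers membership in \<open>M\<close> from the
  equation of the quadric: it is automatic on the sphere, and on the two-sheeted hyperboloid it says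
  that a point whose product with \<open>p\<close> is \<open>- r\<^sup>2 cosh t < 0\<close> lies on the same sheet as \<open>p\<close>.
  The derivative of \<open>S\<close> is \<open>C\<close> in both cases, that of \<open>C\<close> is \<open>- \<epsilon> S\<close>. The assumption \<open>spacelike\<close> makes
  the induced metric Riemannian.
\<close>

locale space_form =
  fixes g :: "'v::euclidean_space \<Rightarrow> 'v \<Rightarrow> real"
    and M :: "'v set" and r \<epsilon> :: real and C S :: "real \<Rightarrow> real"
  assumes bilinear: "bounded_bilinear g"
    and sym: "g x y = g y x"
    and r_pos: "r > 0"
    and sign: "\<epsilon> * \<epsilon> = 1"
    and quadric: "q \<in> M \<Longrightarrow> g q q = \<epsilon> * r\<^sup>2"
    and sheet: "p \<in> M \<Longrightarrow> g y y = \<epsilon> * r\<^sup>2 \<Longrightarrow> g p y = \<epsilon> * r\<^sup>2 * C t \<Longrightarrow> y \<in> M"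
    and spacelike: "q \<in> M \<Longrightarrow> g q v = 0 \<Longrightarrow> v \<noteq> 0 \<Longrightarrow> g v v > 0"
    and pythagoras: "(C t)\<^sup>2 + \<epsilon> * (S t)\<^sup>2 = 1"
    and C_0: "C 0 = 1" and S_0: "S 0 = 0"
    and C_deriv: "(C has_real_derivative - \<epsilon> * S t) (at t)"
    and S_deriv: "(S has_real_derivative C t) (at t)"
    and dim: "2 \<le> DIM('v)"
begin

sublocale form: bounded_bilinear g by (rule bilinear)

lemmas form_simps = form.add_left form.add_right form.diff_left form.diff_right
  form.scaleR_left form.scaleR_right form.zero_left form.zero_right

lemma sign_simps [simp]: "\<epsilon> \<noteq> 0" "\<epsilon> * (\<epsilon> * x) = x"
  using sign by (auto simp flip: mult.assoc)

lemma tangent_nonneg: "q \<in> M \<Longrightarrow> g q v = 0 \<Longrightarrow> g v v \<ge> 0"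
  by (cases "v = 0") (auto simp: form_simps dest: spacelike)

lemma tangent_Cauchy_Schwarz:
  assumes "q \<in> M" "g q u = 0" "g q v = 0"
  shows "(g u v)\<^sup>2 \<le> g u u * g v v"
proof (cases "v = 0")
  case False
  with assms have pos: "g v v > 0" by (simp add: spacelike)
  define x where "x = u - (g u v / g v v) *\<^sub>R v"
  have "0 \<le> g x x"
    using assms by (intro tangent_nonneg[of q]) (auto simp: x_def form_simps)
  also have "g x x = g u u - (g u v)\<^sup>2 / g v v"
    using pos sym[of v u] by (simp add: x_def form_simps field_simps power2_eq_square)
  finally show ?thesis
    using pos by (simp add: field_simps)
qed (simp add: form_simps)

lemma unit_tangent_exists:
  assumes "q \<in> M"
  obtains u where "g q u = 0" "g u u = 1"
proof -
  have "span {q} \<noteq> UNIV"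
  proof
    assume "span {q} = UNIV"
    then have "DIM('v) = dim {q}"
      by (metis dim_UNIV dim_span)
    also have "\<dots> \<le> 1"
      using dim_le_card'[of "{q}"] by simp
    finally show False using dim by simp
  qed
  then obtain y where y: "y \<notin> span {q}" by auto
  have nz: "g q q \<noteq> 0" using quadric[OF assms] r_pos by simp
  define w where "w = y - (g q y / g q q) *\<^sub>R q"
  have w: "g q w = 0" using nz by (simp add: w_def form_simps)
  have "w \<noteq> 0"
    using y by (metis w_def eq_iff_diff_eq_0 span_base span_scale singletonI)
  then have "g w w > 0" using assms w by (simp add: spacelike)
  then have "g ((1 / sqrt (g w w)) *\<^sub>R w) ((1 / sqrt (g w w)) *\<^sub>R w) = 1"
    by (simp add: form_simps)
  then show ?thesis
    using that[of "(1 / sqrt (g w w)) *\<^sub>R w"] w by (simp add: form_simps)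
qed

text \<open>
  Every point is reached from \<open>p\<close> by a geodesic. The direction is the normalized tangential part of
  \<open>q\<close> at \<open>p\<close>; if it vanishes, then \<open>q = \<plusminus>p\<close> and any direction will do.
\<close>

lemma polar_coordinates:
  assumes "p \<in> M" "q \<in> M" "g p q = \<epsilon> * r\<^sup>2 * C \<theta>"
  obtains u where "g p u = 0" "g u u = 1" "q = C \<theta> *\<^sub>R p + (r * S \<theta>) *\<^sub>R u"
proof -
  define w where "w = q - C \<theta> *\<^sub>R p"
  have w: "g p w = 0"
    using assms by (simp add: w_def form_simps quadric)
  have "g w w = \<epsilon> * r\<^sup>2 * (1 - (C \<theta>)\<^sup>2)"
    using assms sym[of q p]
    by (simp add: w_def form_simps quadric power2_eq_square algebra_simps)
  also have "1 - (C \<theta>)\<^sup>2 = \<epsilon> * (S \<theta>)\<^sup>2"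
    using pythagoras[of \<theta>] by simp
  finally have ww: "g w w = (r * S \<theta>)\<^sup>2"
    by (simp add: power_mult_distrib mult.left_commute)
  show ?thesis
  proof (cases "S \<theta> = 0")
    case True
    then have "w = 0"
      using spacelike[OF assms(1) w] ww by auto
    moreover obtain u where "g p u = 0" "g u u = 1"
      using unit_tangent_exists assms(1) by blast
    ultimately show ?thesis
      using that[of u] True by (simp add: w_def)
  next
    case False
    show ?thesis
    proof (rule that)
      show "g p ((1 / (r * S \<theta>)) *\<^sub>R w) = 0"
        by (simp add: form_simps w)
      show "g ((1 / (r * S \<theta>)) *\<^sub>R w) ((1 / (r * S \<theta>)) *\<^sub>R w) = 1"
        using False r_pos by (simp add: form_simps ww power2_eq_square)
      show "q = C \<theta> *\<^sub>R p + (r * S \<theta>) *\<^sub>R ((1 / (r * S \<theta>)) *\<^sub>R w)"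
        using False r_pos by (simp add: w_def)
    qed
  qed
qed

section \<open>Geodesic distance\<close>

text \<open>
  The geodesic is run through at constant speed \<open>r \<theta>\<close> on the unit interval.
\<close>

lemma geodesic_arc:
  assumes "p \<in> M" "g p u = 0" "g u u = 1" "\<theta> \<ge> 0"
    and q: "q = C \<theta> *\<^sub>R p + (r * S \<theta>) *\<^sub>R u"
  obtains \<gamma> where "\<gamma> \<in> connecting_curves g M p q" "integral {0..1} (speed g \<gamma>) = r * \<theta>"
proof -
  define \<gamma> where "\<gamma> t = C (\<theta> * t) *\<^sub>R p + (r * S (\<theta> * t)) *\<^sub>R u" for t
  define v where "v t = (- \<epsilon> * S (\<theta> * t) * \<theta>) *\<^sub>R p + (r * (C (\<theta> * t) * \<theta>)) *\<^sub>R u" for t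
  have up: "g u p = 0" using sym[of u p] assms(2) by simp
  have scaled: "((\<lambda>t. f t *\<^sub>R x) has_vector_derivative f' *\<^sub>R x) (at t)"
    if "(f has_real_derivative f') (at t)" for f f' t and x :: 'v
    using has_vector_derivative_scaleR[OF that has_vector_derivative_const[of x]] by simp
  have deriv: "(\<gamma> has_vector_derivative v t) (at t)" for t
  proof -
    have "((\<lambda>t. C (\<theta> * t)) has_real_derivative - \<epsilon> * S (\<theta> * t) * \<theta>) (at t)"
      by (rule DERIV_chain2[OF C_deriv]) (auto intro!: derivative_eq_intros)
    moreover have "((\<lambda>t. r * S (\<theta> * t)) has_real_derivative r * (C (\<theta> * t) * \<theta>)) (at t)"
      by (rule DERIV_cmult, rule DERIV_chain2[OF S_deriv]) (auto intro!: derivative_eq_intros)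
    ultimately show ?thesis
      unfolding \<gamma>_def[abs_def] v_def
      by (intro has_vector_derivative_add scaled)
  qed
  have vel: "velocity \<gamma> t = v t" for t
    by (rule vector_derivative_at[OF deriv])
  have cont: "continuous_on {0..1} (\<lambda>t. F (\<theta> * t))"
    if "\<And>t. (F has_real_derivative F' t) (at t)" for F F' :: "real \<Rightarrow> real"
  proof (intro continuous_at_imp_continuous_on ballI)
    show "isCont (\<lambda>t. F (\<theta> * t)) t" for t
      by (rule isCont_o2[OF _ DERIV_isCont[OF that]]) (intro isCont_mult continuous_const continuous_ident)
  qed
  have "\<gamma> C1_differentiable_on {0..1}"
    unfolding C1_differentiable_on_def
  proof (intro exI[of _ v] conjI ballI deriv)
    show "continuous_on {0..1} v"
      unfolding v_def[abs_def]
      by (intro continuous_on_add continuous_on_scaleR continuous_on_mult continuous_on_const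
          cont[OF C_deriv] cont[OF S_deriv])
  qed
  then have path: "valid_path \<gamma>"
    unfolding valid_path_def by (rule C1_differentiable_imp_piecewise)
  have "\<gamma> t \<in> M" for t
  proof (rule sheet[OF assms(1)])
    have "g (\<gamma> t) (\<gamma> t) = \<epsilon> * r\<^sup>2 * ((C (\<theta> * t))\<^sup>2 + \<epsilon> * (S (\<theta> * t))\<^sup>2)"
      using assms up by (simp add: \<gamma>_def form_simps quadric power2_eq_square algebra_simps)
    then show "g (\<gamma> t) (\<gamma> t) = \<epsilon> * r\<^sup>2" by (simp only: pythagoras mult_1_right)
    show "g p (\<gamma> t) = \<epsilon> * r\<^sup>2 * C (\<theta> * t)"
      using assms by (simp add: \<gamma>_def form_simps quadric)
  qed
  moreover have "\<gamma> 0 = p" "\<gamma> 1 = q"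
    by (simp_all add: \<gamma>_def q C_0 S_0)
  moreover have speed: "speed g \<gamma> = (\<lambda>_. r * \<theta>)"
  proof
    fix t
    have "g (v t) (v t) = (r * \<theta>)\<^sup>2 * ((C (\<theta> * t))\<^sup>2 + \<epsilon> * (S (\<theta> * t))\<^sup>2)"
      using assms up by (simp add: v_def form_simps quadric power2_eq_square algebra_simps)
    then show "speed g \<gamma> t = r * \<theta>"
      using r_pos \<open>\<theta> \<ge> 0\<close> unfolding speed_def vel pythagoras by simp
  qed
  moreover have "speed g \<gamma> integrable_on {0..1}"
    unfolding speed by (rule integrable_const_ivl)
  ultimately have "\<gamma> \<in> connecting_curves g M p q"
    using path
    by (auto simp: connecting_curves_def path_image_def pathstart_def pathfinish_def)
  moreover have "integral {0..1} (speed g \<gamma>) = r * \<theta>"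
    by (simp add: speed)
  ultimately show ?thesis using that by blast
qed

lemma geodesic_distance_eqI:
  assumes "p \<in> M" "q \<in> M" "g p q = \<epsilon> * r\<^sup>2 * C \<theta>" "\<theta> \<ge> 0"
    and lower: "\<And>\<gamma>. \<gamma> \<in> connecting_curves g M p q \<Longrightarrow> r * \<theta> \<le> integral {0..1} (speed g \<gamma>)"
  shows "geodesic_distance g M p q = r * \<theta>"
proof -
  obtain u where "g p u = 0" "g u u = 1" "q = C \<theta> *\<^sub>R p + (r * S \<theta>) *\<^sub>R u"
    using polar_coordinates assms by blast
  then obtain \<gamma> where \<gamma>: "\<gamma> \<in> connecting_curves g M p q" "integral {0..1} (speed g \<gamma>) = r * \<theta>"
    using geodesic_arc assms by blast
  show ?thesis
    unfolding geodesic_distance_def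
  proof (rule cInf_eq_minimum)
    show "r * \<theta> \<in> (\<lambda>\<gamma>. integral {0..1} (speed g \<gamma>)) ` connecting_curves g M p q"
      using \<gamma> by force
  qed (use lower in auto)
qed

lemma velocity_tangent:
  assumes "(\<gamma> has_vector_derivative v) (at t)" "open U" "t \<in> U" "\<gamma> ` U \<subseteq> M"
  shows "g (\<gamma> t) v = 0"
proof -
  have "((\<lambda>t. g (\<gamma> t) (\<gamma> t)) has_vector_derivative g (\<gamma> t) v + g v (\<gamma> t)) (at t)"
    by (rule form.has_vector_derivative) fact+
  moreover have "((\<lambda>t. g (\<gamma> t) (\<gamma> t)) has_vector_derivative 0) (at t)"
    by (rule has_vector_derivative_transform_within_open[where f = "\<lambda>_. \<epsilon> * r\<^sup>2", OF _ assms(2,3)])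
       (use assms(4) quadric in \<open>auto simp: image_subset_iff\<close>)
  ultimately show ?thesis
    using vector_derivative_unique_at sym[of v] by fastforce
qed

text \<open>
  A function \<open>h\<close> of the normalized product \<open>g p \<gamma> / (\<epsilon> r\<^sup>2)\<close> cannot grow faster than the arc length
  divided by \<open>r\<close> if \<open>\<bar>h' x\<bar> sqrt (\<epsilon> (1 - x\<^sup>2)) \<le> 1\<close>: the gradient of the product along \<open>M\<close> is the
  tangential part of \<open>p\<close>, of squared length \<open>\<epsilon> r\<^sup>2 (1 - x\<^sup>2)\<close>. The inverse functions of \<open>C\<close> are the
  extremal choices of \<open>h\<close>, which are singular at \<open>1\<close>; hence the general \<open>h\<close>.
\<close>

lemma length_lower_bound:
  assumes p: "p \<in> M" and \<gamma>: "\<gamma> \<in> connecting_curves g M p q"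
    and D: "\<And>x. x \<in> M \<Longrightarrow> g p x / (\<epsilon> * r\<^sup>2) \<in> D"
    and h: "\<And>x. x \<in> D \<Longrightarrow> (h has_real_derivative h' x) (at x)"
    and h': "\<And>x. x \<in> D \<Longrightarrow> \<bar>h' x\<bar> * sqrt (\<epsilon> * (1 - x\<^sup>2)) \<le> 1"
  shows "r * (h (g p q / (\<epsilon> * r\<^sup>2)) - h 1) \<le> integral {0..1} (speed g \<gamma>)"
proof -
  define f where "f t = g p (\<gamma> t) / (\<epsilon> * r\<^sup>2)" for t
  from \<gamma> obtain K where cont: "continuous_on {0..1} \<gamma>" and K: "finite K"
    and C1: "\<gamma> C1_differentiable_on ({0..1} - K)"
    and M: "\<gamma> ` {0..1} \<subseteq> M" and ends: "\<gamma> 0 = p" "\<gamma> 1 = q"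
    and int: "speed g \<gamma> integrable_on {0..1}"
    by (auto simp: connecting_curves_def valid_path_def piecewise_C1_differentiable_on_def
        path_image_def pathstart_def pathfinish_def)
  have fD: "f t \<in> D" if "t \<in> {0..1}" for t
    unfolding f_def using that M by (intro D) auto
  \<comment> \<open>The value off the set of smooth points is chosen so that the bound by the speed holds everywhere.\<close>
  define d where
    "d t = (if t \<in> {0<..<1} - K then h' (f t) * (g p (velocity \<gamma> t) / (\<epsilon> * r\<^sup>2)) else speed g \<gamma> t / r)" for t
  have deriv: "((\<lambda>t. h (f t)) has_vector_derivative d t) (at t)"
    and bound: "d t \<le> speed g \<gamma> t / r" if t: "t \<in> {0<..<1} - K" for t
  proof -
    have v: "(\<gamma> has_vector_derivative velocity \<gamma> t) (at t)"
      using C1 t by (auto simp: C1_differentiable_on_eq vector_derivative_works)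
    have "(f has_vector_derivative g p (velocity \<gamma> t) / (\<epsilon> * r\<^sup>2)) (at t)"
      unfolding f_def[abs_def]
      by (intro has_vector_derivative_divide
          bounded_linear.has_vector_derivative[OF form.bounded_linear_right] v)
    then have "(f has_real_derivative g p (velocity \<gamma> t) / (\<epsilon> * r\<^sup>2)) (at t)"
      by (simp add: has_real_derivative_iff_has_vector_derivative)
    from DERIV_chain2[OF h this] fD t
    show "((\<lambda>t. h (f t)) has_vector_derivative d t) (at t)"
      by (auto simp: d_def has_real_derivative_iff_has_vector_derivative)
    have Mt: "\<gamma> t \<in> M" using M t by auto
    \<comment> \<open>The tangential part of the base point at \<open>\<gamma> t\<close>.\<close>
    define w where "w = p - f t *\<^sub>R \<gamma> t"
    have pf: "g p (\<gamma> t) = \<epsilon> * r\<^sup>2 * f t" using r_pos by (simp add: f_def)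
    have w: "g (\<gamma> t) w = 0"
      using pf sym[of "\<gamma> t" p] by (simp add: w_def form_simps quadric Mt)
    have tang: "g (\<gamma> t) (velocity \<gamma> t) = 0"
      by (rule velocity_tangent[OF v, of "{0<..<1}"]) (use t M in \<open>auto simp: image_subset_iff\<close>)
    have ww: "g w w = r\<^sup>2 * (\<epsilon> * (1 - (f t)\<^sup>2))"
      using pf sym[of "\<gamma> t" p]
      by (simp add: w_def form_simps quadric Mt p power2_eq_square algebra_simps)
    have "(g p (velocity \<gamma> t))\<^sup>2 = (g w (velocity \<gamma> t))\<^sup>2"
      by (simp add: w_def form_simps tang)
    also have "\<dots> \<le> g w w * g (velocity \<gamma> t) (velocity \<gamma> t)"
      by (rule tangent_Cauchy_Schwarz[OF Mt w tang])
    finally have "\<bar>g p (velocity \<gamma> t)\<bar> \<le> sqrt (g w w * g (velocity \<gamma> t) (velocity \<gamma> t))"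
      using real_le_rsqrt by (metis real_sqrt_abs real_sqrt_le_mono)
    also have "\<dots> = r * sqrt (\<epsilon> * (1 - (f t)\<^sup>2)) * speed g \<gamma> t"
      using r_pos by (simp add: ww real_sqrt_mult speed_def)
    finally have "\<bar>g p (velocity \<gamma> t)\<bar> \<le> r * sqrt (\<epsilon> * (1 - (f t)\<^sup>2)) * speed g \<gamma> t" .
    then have "\<bar>h' (f t)\<bar> * \<bar>g p (velocity \<gamma> t)\<bar> \<le>
        (\<bar>h' (f t)\<bar> * sqrt (\<epsilon> * (1 - (f t)\<^sup>2))) * (r * speed g \<gamma> t)"
      using mult_left_mono[of _ _ "\<bar>h' (f t)\<bar>"] by (fastforce simp: algebra_simps)
    also have "\<dots> \<le> 1 * (r * speed g \<gamma> t)"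
      using h' fD t r_pos tangent_nonneg[OF Mt tang]
      by (intro mult_right_mono) (auto simp: speed_def)
    finally have "\<bar>h' (f t)\<bar> * \<bar>g p (velocity \<gamma> t)\<bar> / r\<^sup>2 \<le> speed g \<gamma> t / r"
      using r_pos by (simp add: field_simps power2_eq_square)
    moreover have "\<bar>d t\<bar> = \<bar>h' (f t)\<bar> * \<bar>g p (velocity \<gamma> t)\<bar> / r\<^sup>2"
      using t sign by (auto simp: d_def abs_mult square_eq_1_iff)
    ultimately show "d t \<le> speed g \<gamma> t / r" by linarith
  qed
  have "(d has_integral (h (f 1) - h (f 0))) {0..1}"
  proof (rule fundamental_theorem_of_calculus_interior_strong[OF K])
    have "continuous_on D h"
      using h by (meson DERIV_isCont continuous_at_imp_continuous_on)
    moreover have "continuous_on {0..1} f"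
      unfolding f_def[abs_def]
      using r_pos by (intro continuous_intros form.continuous_on cont) auto
    moreover have "f ` {0..1} \<subseteq> D" using fD by blast
    ultimately show "continuous_on {0..1} (\<lambda>t. h (f t))"
      by (rule continuous_on_compose2)
  qed (use deriv in auto)
  moreover have "((\<lambda>t. speed g \<gamma> t / r) has_integral (integral {0..1} (speed g \<gamma>) / r)) {0..1}"
    by (intro has_integral_divide integrable_integral int)
  moreover have "d t \<le> speed g \<gamma> t / r" for t
    using bound[of t] by (cases "t \<in> {0<..<1} - K") (auto simp: d_def)
  ultimately have "h (f 1) - h (f 0) \<le> integral {0..1} (speed g \<gamma>) / r"
    by (rule has_integral_le)
  then show ?thesis
    using r_pos p by (simp add: f_def ends quadric field_simps)
qed

section \<open>Curves with a rotation minimizing frame\<close>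

text \<open>
  A curve lies in a hyperplane section with center \<open>p\<close> exactly if \<open>p\<close> has constant coordinates
  \<open>C \<theta>\<close>, \<open>0\<close>, \<open>- r S \<theta> a\<^sub>i\<close> in the moving basis consisting of the position, the velocity and the frame.
  The curvature relation is the vanishing of the derivative of the vector with these coordinates.
\<close>

lemma spherical_iff_curvature_relation:
  fixes n :: "'m::finite \<Rightarrow> real \<Rightarrow> 'v" and \<kappa> :: "'m \<Rightarrow> real \<Rightarrow> real"
  assumes curve: "arclength_curve g M I \<alpha>"
    and frame: "rotation_minimizing_frame g I \<alpha> n \<kappa>"
    and card: "DIM('v) = CARD('m) + 2"
    and S_pos: "S \<theta> > 0"
  shows "(\<exists>p\<in>M. \<forall>s\<in>I. g p (\<alpha> s) = \<epsilon> * r\<^sup>2 * C \<theta>) \<longleftrightarrow>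
         (\<exists>a. (\<Sum>i\<in>UNIV. (a i)\<^sup>2) = 1 \<and>
              (\<forall>s\<in>I. (\<Sum>i\<in>UNIV. a i * \<kappa> i s) + 1 / r * (C \<theta> / S \<theta>) = 0))"
    (is "?spherical \<longleftrightarrow> ?relation")
proof -
  define T where "T = velocity \<alpha>"
  from curve obtain s\<^sub>0 where s\<^sub>0: "s\<^sub>0 \<in> I" by (auto simp: arclength_curve_def)
  have I: "open I" "convex I"
    using curve by (auto simp: arclength_curve_def is_interval_convex)
  have \<alpha>M: "\<alpha> s \<in> M" if "s \<in> I" for s
    using curve that by (auto simp: arclength_curve_def)
  have \<alpha>': "(\<alpha> has_vector_derivative T s) (at s)" if "s \<in> I" for s
    using curve that
    by (auto simp: arclength_curve_def C1_differentiable_on_eq vector_derivative_works T_def)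
  have orth: "g (\<alpha> s) (T s) = 0" "g (T s) (T s) = 1" "g (\<alpha> s) (n i s) = 0" "g (T s) (n i s) = 0"
      "g (n i s) (n j s) = (if i = j then 1 else 0)" if "s \<in> I" for s i j
    using frame that by (auto simp: rotation_minimizing_frame_def tangent_space_def T_def)
  have orth': "g (T s) (\<alpha> s) = 0" "g (n i s) (\<alpha> s) = 0" "g (n i s) (T s) = 0" if "s \<in> I" for s i
    using orth[OF that] sym by metis+
  \<comment> \<open>The covariant derivative of the frame is its ordinary derivative.\<close>
  have n': "(n i has_vector_derivative - \<kappa> i s *\<^sub>R T s) (at s)" if s: "s \<in> I" for s i
  proof -
    have v: "(n i has_vector_derivative velocity (n i) s) (at s)"
      using frame s
      by (auto simp: rotation_minimizing_frame_def C1_differentiable_on_eq vector_derivative_works)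
    have "((\<lambda>s. g (\<alpha> s) (n i s)) has_vector_derivative
        g (\<alpha> s) (velocity (n i) s) + g (T s) (n i s)) (at s)"
      by (rule form.has_vector_derivative[OF \<alpha>'[OF s] v])
    moreover have "((\<lambda>s. g (\<alpha> s) (n i s)) has_vector_derivative 0) (at s)"
      by (rule has_vector_derivative_transform_within_open[where f = "\<lambda>_. 0", OF _ I(1) s])
         (auto simp: orth)
    ultimately have "g (\<alpha> s) (velocity (n i) s) = 0"
      using vector_derivative_unique_at orth(4)[OF s] by fastforce
    then have "velocity (n i) s = covariant_derivative g \<alpha> (n i) s"
      by (simp add: covariant_derivative_def tangential_part_def)
    also have "\<dots> = - \<kappa> i s *\<^sub>R T s"
      using frame s by (simp add: rotation_minimizing_frame_def T_def)
    finally show ?thesis using v by simp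
  qed
  have const: "\<exists>c. \<forall>s\<in>I. F s = c"
    if "\<And>s. s \<in> I \<Longrightarrow> (F has_vector_derivative 0) (at s)" for F :: "real \<Rightarrow> 'w::real_normed_vector"
    using has_vector_derivative_zero_constant[OF I(2)] that
    by (metis has_vector_derivative_at_within)
  show ?thesis
  proof
    assume ?spherical
    then obtain p where p: "p \<in> M" and sph: "\<And>s. s \<in> I \<Longrightarrow> g p (\<alpha> s) = \<epsilon> * r\<^sup>2 * C \<theta>" by blast
    have pT: "g p (T s) = 0" if s: "s \<in> I" for s
    proof -
      have "((\<lambda>s. g p (\<alpha> s)) has_vector_derivative g p (T s)) (at s)"
        by (rule bounded_linear.has_vector_derivative[OF form.bounded_linear_right \<alpha>'[OF s]])
      moreover have "((\<lambda>s. g p (\<alpha> s)) has_vector_derivative 0) (at s)"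
        by (rule has_vector_derivative_transform_within_open[where f = "\<lambda>_. \<epsilon> * r\<^sup>2 * C \<theta>", OF _ I(1) s])
           (auto simp: sph)
      ultimately show ?thesis using vector_derivative_unique_at by blast
    qed
    have "\<exists>c. \<forall>s\<in>I. g p (n i s) = c" for i
    proof (rule const)
      fix s assume s: "s \<in> I"
      show "((\<lambda>s. g p (n i s)) has_vector_derivative 0) (at s)"
        using bounded_linear.has_vector_derivative[OF form.bounded_linear_right n'[OF s]]
          pT[OF s] by (metis form.scaleR_right scaleR_zero_right)
    qed
    then obtain b where b: "\<And>s i. s \<in> I \<Longrightarrow> g p (n i s) = b i" by metis
    have expand: "p = C \<theta> *\<^sub>R \<alpha> s + (\<Sum>i\<in>UNIV. b i *\<^sub>R n i s)" if s: "s \<in> I" for s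
    proof -
      \<comment> \<open>The moving basis, indexed by the coordinates of the ambient space.\<close>
      define e where "e k = (case k of None \<Rightarrow> \<alpha> s | Some None \<Rightarrow> T s | Some (Some i) \<Rightarrow> n i s)"
        for k :: "'m option option"
      have "p = (\<Sum>k\<in>UNIV. (g p (e k) / g (e k) (e k)) *\<^sub>R e k)"
      proof (rule orthogonal_family_expansion[OF bilinear])
        show "g (e i) (e j) = 0" if "i \<noteq> j" for i j
          using that orth[OF s] orth'[OF s]
          by (auto simp: e_def split: option.splits)
        show "g (e i) (e i) \<noteq> 0" for i
          using orth[OF s] quadric[OF \<alpha>M[OF s]] r_pos by (auto simp: e_def split: option.splits)
      qed (simp add: card)
      also have "\<dots> = C \<theta> *\<^sub>R \<alpha> s + (\<Sum>i\<in>UNIV. b i *\<^sub>R n i s)"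
        using orth[OF s] quadric[OF \<alpha>M[OF s]] r_pos
        by (simp add: sum_option e_def pT[OF s] sph[OF s] b[OF s])
      finally show ?thesis .
    qed
    have rel: "(\<Sum>i\<in>UNIV. b i * \<kappa> i s) = C \<theta>" if s: "s \<in> I" for s
    proof -
      have "((\<lambda>s. C \<theta> *\<^sub>R \<alpha> s + (\<Sum>i\<in>UNIV. b i *\<^sub>R n i s)) has_vector_derivative
          C \<theta> *\<^sub>R T s + (\<Sum>i\<in>UNIV. b i *\<^sub>R (- \<kappa> i s *\<^sub>R T s))) (at s)"
        by (intro has_vector_derivative_add has_vector_derivative_sum
            bounded_linear.has_vector_derivative[OF bounded_linear_scaleR_right] \<alpha>'[OF s] n'[OF s])
      moreover have "((\<lambda>s. C \<theta> *\<^sub>R \<alpha> s + (\<Sum>i\<in>UNIV. b i *\<^sub>R n i s)) has_vector_derivative 0) (at s)"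
        by (rule has_vector_derivative_transform_within_open[where f = "\<lambda>_. p", OF _ I(1) s])
           (auto simp: expand[symmetric])
      ultimately have "0 = C \<theta> *\<^sub>R T s + (\<Sum>i\<in>UNIV. b i *\<^sub>R (- \<kappa> i s *\<^sub>R T s))"
        using vector_derivative_unique_at by blast
      also have "\<dots> = (C \<theta> - (\<Sum>i\<in>UNIV. b i * \<kappa> i s)) *\<^sub>R T s"
        by (simp add: scaleR_sum_left sum_negf scaleR_diff_left)
      finally have "(C \<theta> - (\<Sum>i\<in>UNIV. b i * \<kappa> i s)) *\<^sub>R T s = 0" by simp
      moreover have "T s \<noteq> 0" using orth(2)[OF s] by (auto simp: form_simps)
      ultimately show ?thesis by simp
    qed
    have "\<epsilon> * r\<^sup>2 = g p (C \<theta> *\<^sub>R \<alpha> s\<^sub>0 + (\<Sum>i\<in>UNIV. b i *\<^sub>R n i s\<^sub>0))"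
      using quadric[OF p] expand[OF s\<^sub>0] by simp
    also have "\<dots> = \<epsilon> * r\<^sup>2 * (C \<theta>)\<^sup>2 + (\<Sum>i\<in>UNIV. (b i)\<^sup>2)"
      by (simp add: form_simps form.sum_right sph[OF s\<^sub>0] b[OF s\<^sub>0] power2_eq_square)
    finally have "(\<Sum>i\<in>UNIV. (b i)\<^sup>2) = \<epsilon> * r\<^sup>2 * (1 - (C \<theta>)\<^sup>2)"
      unfolding right_diff_distrib by linarith
    also have "1 - (C \<theta>)\<^sup>2 = \<epsilon> * (S \<theta>)\<^sup>2"
      using pythagoras[of \<theta>] by simp
    finally have norm_b: "(\<Sum>i\<in>UNIV. (b i)\<^sup>2) = (r * S \<theta>)\<^sup>2"
      by (simp add: power_mult_distrib mult.left_commute)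
    show ?relation
    proof (intro exI[of _ "\<lambda>i. - b i / (r * S \<theta>)"] conjI ballI)
      show "(\<Sum>i\<in>UNIV. (- b i / (r * S \<theta>))\<^sup>2) = 1"
        using r_pos S_pos by (simp add: power_divide norm_b flip: sum_divide_distrib)
      show "(\<Sum>i\<in>UNIV. - b i / (r * S \<theta>) * \<kappa> i s) + 1 / r * (C \<theta> / S \<theta>) = 0" if "s \<in> I" for s
        using rel[OF that] by (simp add: sum_negf flip: sum_divide_distrib)
    qed
  next
    assume ?relation
    then obtain a where a: "(\<Sum>i\<in>UNIV. (a i)\<^sup>2) = 1"
      and rel: "\<And>s. s \<in> I \<Longrightarrow> (\<Sum>i\<in>UNIV. a i * \<kappa> i s) + 1 / r * (C \<theta> / S \<theta>) = 0" by blast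
    define P where "P s = C \<theta> *\<^sub>R \<alpha> s - (r * S \<theta>) *\<^sub>R (\<Sum>i\<in>UNIV. a i *\<^sub>R n i s)" for s
    have "\<exists>p. \<forall>s\<in>I. P s = p"
    proof (rule const)
      fix s assume s: "s \<in> I"
      have "(P has_vector_derivative
          C \<theta> *\<^sub>R T s - (r * S \<theta>) *\<^sub>R (\<Sum>i\<in>UNIV. a i *\<^sub>R (- \<kappa> i s *\<^sub>R T s))) (at s)"
        unfolding P_def[abs_def]
        by (intro has_vector_derivative_diff has_vector_derivative_sum
            bounded_linear.has_vector_derivative[OF bounded_linear_scaleR_right] \<alpha>'[OF s] n'[OF s])
      also have "C \<theta> *\<^sub>R T s - (r * S \<theta>) *\<^sub>R (\<Sum>i\<in>UNIV. a i *\<^sub>R (- \<kappa> i s *\<^sub>R T s)) =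
          (C \<theta> + r * S \<theta> * (\<Sum>i\<in>UNIV. a i * \<kappa> i s)) *\<^sub>R T s"
        by (simp add: scaleR_sum_left sum_negf scaleR_add_left flip: scaleR_scaleR)
      also have "C \<theta> + r * S \<theta> * (\<Sum>i\<in>UNIV. a i * \<kappa> i s) = 0"
        using rel[OF s] r_pos S_pos by (simp add: field_simps)
      finally show "(P has_vector_derivative 0) (at s)" by simp
    qed
    then obtain p where p: "\<And>s. s \<in> I \<Longrightarrow> P s = p" by blast
    have Pn: "g (\<alpha> s) (\<Sum>i\<in>UNIV. a i *\<^sub>R n i s) = 0"
      "g (\<Sum>i\<in>UNIV. a i *\<^sub>R n i s) (\<alpha> s) = 0"
      and nn: "g (\<Sum>i\<in>UNIV. a i *\<^sub>R n i s) (\<Sum>i\<in>UNIV. a i *\<^sub>R n i s) = 1" if s: "s \<in> I" for s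
      using a orth[OF s] orth'[OF s]
      by (simp_all add: form.sum_right form.sum_left form_simps power2_eq_square mult_delta_right)
    have sph: "g p (\<alpha> s) = \<epsilon> * r\<^sup>2 * C \<theta>" if s: "s \<in> I" for s
      using Pn[OF s] quadric[OF \<alpha>M[OF s]]
      by (simp add: P_def form_simps flip: p[OF s])
    have "g p p = \<epsilon> * r\<^sup>2 * ((C \<theta>)\<^sup>2 + \<epsilon> * (S \<theta>)\<^sup>2)"
      using Pn[OF s\<^sub>0] nn[OF s\<^sub>0] quadric[OF \<alpha>M[OF s\<^sub>0]]
      by (simp add: P_def form_simps power2_eq_square algebra_simps flip: p[OF s\<^sub>0])
    then have "g p p = \<epsilon> * r\<^sup>2" by (simp only: pythagoras mult_1_right)
    then have "p \<in> M"
      using sheet[OF \<alpha>M[OF s\<^sub>0]] sph[OF s\<^sub>0] sym[of p] by metis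
    with sph show ?spherical by blast
  qed
qed

end

section \<open>The sphere\<close>

lemma space_form_sphere:
  assumes "r > 0" and "2 \<le> DIM('v::euclidean_space)"
  shows "space_form inner (sphere (0::'v) r) r 1 cos sin"
proof (rule space_form.intro)
  show "bounded_bilinear (inner :: 'v \<Rightarrow> _)" by (rule bounded_bilinear_inner)
  show "y \<in> sphere 0 r" if "inner y y = 1 * r\<^sup>2" for y :: 'v
    using that assms(1) by (simp add: norm_eq_sqrt_inner)
qed (use assms in \<open>auto simp: inner_commute dot_square_norm
      intro!: derivative_eq_intros\<close>)

text \<open>
  The lower bound integrates the derivative of \<open>arccos (c x)\<close> with \<open>c < 1\<close>, which is admissible since
  \<open>c\<^sup>2 (1 - x\<^sup>2) \<le> 1 - (c x)\<^sup>2\<close>, and lets \<open>c\<close> tend to \<open>1\<close>.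
\<close>

lemma geodesic_distance_sphere:
  fixes p q :: "'v::euclidean_space"
  assumes "r > 0" "2 \<le> DIM('v)" and p: "p \<in> sphere 0 r" and q: "q \<in> sphere 0 r"
  shows "geodesic_distance inner (sphere 0 r) p q = r * arccos (inner p q / r\<^sup>2)"
proof -
  interpret space_form inner "sphere (0::'v) r" r 1 cos sin
    by (rule space_form_sphere) fact+
  have range: "inner p x / r\<^sup>2 \<in> {-1..1}" if "x \<in> sphere 0 r" for x
    using Cauchy_Schwarz_ineq2[of p x] p that \<open>r > 0\<close>
    by (auto simp: abs_le_iff field_simps power2_eq_square)
  define \<sigma> where "\<sigma> = inner p q / r\<^sup>2"
  have \<sigma>: "-1 \<le> \<sigma>" "\<sigma> \<le> 1" using range[OF q] by (auto simp: \<sigma>_def)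
  show ?thesis
    unfolding \<sigma>_def[symmetric]
  proof (rule geodesic_distance_eqI[OF p q])
    show "inner p q = 1 * r\<^sup>2 * cos (arccos \<sigma>)"
      using \<sigma> \<open>r > 0\<close> by (simp add: \<sigma>_def)
    show "0 \<le> arccos \<sigma>" using \<sigma> by (simp add: arccos_lbound)
    fix \<gamma> assume \<gamma>: "\<gamma> \<in> connecting_curves inner (sphere 0 r) p q"
    have bound: "r * (arccos (c * \<sigma>) - arccos c) \<le> integral {0..1} (speed inner \<gamma>)" if c: "0 < c" "c < 1" for c
    proof -
      have less: "(c * x)\<^sup>2 < 1" if "x \<in> {-1..1}" for x
      proof -
        have "\<bar>c * x\<bar> \<le> c * 1"
          using c that by (auto simp: abs_mult intro!: mult_left_mono)
        then show ?thesis using c by (simp add: abs_square_less_1)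
      qed
      have "r * (arccos (c * (inner p q / (1 * r\<^sup>2))) - arccos (c * 1)) \<le> integral {0..1} (speed inner \<gamma>)"
      proof (rule length_lower_bound[OF p \<gamma>, where D = "{-1..1}"
            and h' = "\<lambda>x. - (c / sqrt (1 - (c * x)\<^sup>2))"])
        fix x :: real assume x: "x \<in> {-1..1}"
        have "((*) c has_real_derivative c) (at x)"
          by (rule DERIV_cmult_Id)
        moreover have "- 1 < c * x" "c * x < 1"
          using less[OF x] by (auto simp: abs_square_less_1)
        ultimately show "((\<lambda>x. arccos (c * x)) has_real_derivative - (c / sqrt (1 - (c * x)\<^sup>2))) (at x)"
          using DERIV_chain2[OF DERIV_arccos] by (fastforce simp: field_simps)
        have "c\<^sup>2 \<le> 1" using c by (simp add: power_le_one)
        then have "sqrt (c\<^sup>2 * (1 - x\<^sup>2)) \<le> sqrt (1 - (c * x)\<^sup>2)"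
          by (simp add: algebra_simps)
        then have "c * sqrt (1 - x\<^sup>2) \<le> sqrt (1 - (c * x)\<^sup>2)"
          using c by (simp add: real_sqrt_mult)
        then show "\<bar>- (c / sqrt (1 - (c * x)\<^sup>2))\<bar> * sqrt (1 * (1 - x\<^sup>2)) \<le> 1"
          using less[OF x] c by (simp add: abs_div)
      qed (use range in simp)
      then show ?thesis by (simp add: \<sigma>_def)
    qed
    have lim: "((\<lambda>c. r * (arccos (c * \<sigma>) - arccos c)) \<longlongrightarrow> r * (arccos (1 * \<sigma>) - arccos 1)) (at_left 1)"
    proof -
      have near: "\<forall>\<^sub>F c in at_left (1::real). c \<in> {0<..<1}"
        by (rule eventually_at_leftI[of 0]) auto
      have "((\<lambda>c. arccos (c * y)) \<longlongrightarrow> arccos (1 * y)) (at_left 1)" if y: "\<bar>y\<bar> \<le> 1" for y :: real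
      proof (rule continuous_on_tendsto_compose[OF continuous_on_arccos'])
        show "((\<lambda>c. c * y) \<longlongrightarrow> 1 * y) (at_left 1)" by (intro tendsto_intros)
        show "\<forall>\<^sub>F c in at_left 1. c * y \<in> {-1..1}"
          using near
        proof eventually_elim
          case (elim c)
          then have "\<bar>c * y\<bar> \<le> 1 * 1"
            unfolding abs_mult using y by (intro mult_mono) auto
          then show ?case by auto
        qed
      qed (use y in auto)
      from this[of \<sigma>] this[of 1] show ?thesis
        using \<sigma> by (intro tendsto_mult tendsto_diff tendsto_const) auto
    qed
    have "\<forall>\<^sub>F c in at_left 1. r * (arccos (c * \<sigma>) - arccos c) \<le> integral {0..1} (speed inner \<gamma>)"
      by (rule eventually_at_leftI[of 0]) (use bound in auto)
    from tendsto_upperbound[OF lim this]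
    show "r * arccos \<sigma> \<le> integral {0..1} (speed inner \<gamma>)" by simp
  qed
qed

lemma mem_geodesic_sphere_in_sphere:
  fixes p :: "'v::euclidean_space"
  assumes "r > 0" "2 \<le> DIM('v)" "p \<in> sphere 0 r" "0 < z" "z < pi * r / 2"
  shows "q \<in> geodesic_sphere inner (sphere 0 r) p z \<longleftrightarrow>
    q \<in> sphere 0 r \<and> inner p q = 1 * r\<^sup>2 * cos (z / r)"
proof (cases "q \<in> sphere 0 r")
  case True
  have z: "0 \<le> z / r" "z / r \<le> pi"
    using assms pi_gt_zero by (auto simp: field_simps)
  have \<sigma>: "\<bar>inner p q / r\<^sup>2\<bar> \<le> 1"
    using Cauchy_Schwarz_ineq2[of p q] assms True
    by (auto simp: field_simps power2_eq_square)
  have "r * arccos (inner p q / r\<^sup>2) = z \<longleftrightarrow> arccos (inner p q / r\<^sup>2) = z / r"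
    using assms(1) by (auto simp: field_simps)
  also have "\<dots> \<longleftrightarrow> inner p q / r\<^sup>2 = cos (z / r)"
    using z \<sigma> by (metis abs_le_iff arccos_cos cos_arccos minus_le_iff)
  also have "\<dots> \<longleftrightarrow> inner p q = 1 * r\<^sup>2 * cos (z / r)"
    using assms(1) by (auto simp: field_simps)
  finally show ?thesis
    using True geodesic_distance_sphere[OF assms(1,2,3) True] by (simp add: geodesic_sphere_def)
qed (simp add: geodesic_sphere_def)

section \<open>Hyperbolic space\<close>

definition spatial :: "real ^ 'k::finite option \<Rightarrow> real ^ 'k option \<Rightarrow> real" where
  "spatial x y = (\<Sum>i\<in>UNIV - {None}. x $ i * y $ i)"

lemma lorentz_spatial: "lorentz x y = spatial x y - x $ None * y $ None"
  by (simp add: lorentz_def spatial_def)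

lemma spatial_nonneg: "spatial x x \<ge> 0"
  by (simp add: spatial_def sum_nonneg)

lemma spatial_Cauchy_Schwarz: "(spatial x y)\<^sup>2 \<le> spatial x x * spatial y y"
  using Cauchy_Schwarz_ineq_sum[of "($) x" "($) y" "UNIV - {None}"]
  by (simp add: spatial_def power2_eq_square)

lemma spatial_eq_0D:
  assumes "spatial v v = 0" "i \<noteq> None"
  shows "v $ i = 0"
  using assms by (simp add: spatial_def sum_nonneg_eq_0_iff)

text \<open>
  If \<open>v\<close> is orthogonal to a timelike vector \<open>q\<close>, then \<open>q\<^sub>0 v\<^sub>0\<close> is the spatial product of \<open>q\<close> and \<open>v\<close>,
  and the Cauchy-Schwarz inequality for the spatial part bounds \<open>v\<^sub>0\<^sup>2\<close> strictly by the spatial square of \<open>v\<close>.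
\<close>

lemma lorentz_spacelike:
  assumes "q \<in> hyperbolic_space r" "r > 0" "lorentz q v = 0" "v \<noteq> 0"
  shows "lorentz v v > 0"
proof -
  have q: "spatial q q = (q $ None)\<^sup>2 - r\<^sup>2" "q $ None > 0"
    using assms(1) by (auto simp: hyperbolic_space_def lorentz_spatial power2_eq_square)
  have "(q $ None)\<^sup>2 * (v $ None)\<^sup>2 = (spatial q v)\<^sup>2"
    using assms(3) by (simp add: lorentz_spatial power_mult_distrib)
  also have "\<dots> \<le> ((q $ None)\<^sup>2 - r\<^sup>2) * spatial v v"
    using spatial_Cauchy_Schwarz[of q v] q by simp
  finally have le: "r\<^sup>2 * spatial v v \<le> (q $ None)\<^sup>2 * lorentz v v"
    by (simp add: lorentz_spatial power2_eq_square algebra_simps)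
  have "spatial v v \<noteq> 0"
  proof
    assume 0: "spatial v v = 0"
    then have "(spatial q v)\<^sup>2 \<le> 0" using spatial_Cauchy_Schwarz[of q v] by simp
    then have "v $ None = 0" using assms(3) q by (simp add: lorentz_spatial)
    with 0 have "v = 0" by (metis spatial_eq_0D vec_eq_iff zero_index)
    with assms(4) show False by simp
  qed
  then have "r\<^sup>2 * spatial v v > 0"
    using spatial_nonneg[of v] assms(2) by simp
  with le have "(q $ None)\<^sup>2 * lorentz v v > 0" by linarith
  then show ?thesis by (simp add: zero_less_mult_iff)
qed

text \<open>
  The sign of \<open>lorentz x y\<close> on the hyperboloid is therefore determined by the first coordinates alone:
  it is negative exactly if \<open>x\<close> and \<open>y\<close> lie on the same sheet.
\<close>

lemma spatial_less_on_quadric: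
  assumes "r > 0" "lorentz x x = - r\<^sup>2" "lorentz y y = - r\<^sup>2"
  shows "\<bar>spatial x y\<bar> < \<bar>x $ None\<bar> * \<bar>y $ None\<bar>"
proof -
  have *: "spatial x x < (x $ None)\<^sup>2" "spatial y y < (y $ None)\<^sup>2"
    using assms zero_less_power[OF \<open>r > 0\<close>, of 2]
    unfolding lorentz_spatial power2_eq_square by linarith+
  have "(spatial x y)\<^sup>2 \<le> spatial x x * spatial y y"
    by (rule spatial_Cauchy_Schwarz)
  also have "\<dots> < (x $ None)\<^sup>2 * (y $ None)\<^sup>2"
    using * spatial_nonneg by (intro mult_strict_mono') 
  finally have "\<bar>spatial x y\<bar>\<^sup>2 < (\<bar>x $ None\<bar> * \<bar>y $ None\<bar>)\<^sup>2"
    by (simp add: power_mult_distrib)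
  then show ?thesis by (rule power2_less_imp_less) simp
qed

lemma space_form_hyperbolic:
  assumes "r > 0"
  shows "space_form lorentz (hyperbolic_space r :: (real ^ 'k::finite option) set) r (-1) cosh sinh"
proof (rule space_form.intro)
  show "bounded_bilinear (lorentz :: real ^ 'k option \<Rightarrow> _)"
    by (rule bounded_bilinear_lorentz)
  show "lorentz x y = lorentz y x" for x y :: "real ^ 'k option"
    by (rule lorentz_commute)
  show "0 < lorentz v v" if "q \<in> hyperbolic_space r" "lorentz q v = 0" "v \<noteq> 0" for q v :: "real ^ 'k option"
    using lorentz_spacelike that assms by blast
  show "y \<in> hyperbolic_space r"
    if p: "p \<in> hyperbolic_space r" and y: "lorentz y y = - 1 * r\<^sup>2"
      and t: "lorentz p y = - 1 * r\<^sup>2 * cosh t" for p y :: "real ^ 'k option" and t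
  proof -
    have "lorentz p y < 0"
      using t assms cosh_real_pos[of t] by simp
    moreover have "\<bar>spatial p y\<bar> < \<bar>p $ None\<bar> * \<bar>y $ None\<bar>"
      using p y assms by (intro spatial_less_on_quadric) (auto simp: hyperbolic_space_def)
    moreover have "p $ None > 0" using p by (simp add: hyperbolic_space_def)
    ultimately have "y $ None > 0"
      by (cases "y $ None > 0") (auto simp: lorentz_spatial)
    with y show ?thesis by (simp add: hyperbolic_space_def)
  qed
qed (use assms in \<open>auto simp: hyperbolic_space_def cosh_square_eq intro!: derivative_eq_intros\<close>)

text \<open>
  The lower bound uses \<open>arcosh (c x)\<close> with \<open>c > 1\<close>, which is admissible since
  \<open>c\<^sup>2 (x\<^sup>2 - 1) \<le> (c x)\<^sup>2 - 1\<close>. The first claim is the reversed Cauchy-Schwarz inequality, needed for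
  \<open>arcosh\<close> to be meaningful: the tangential part of \<open>p\<close> at another point has nonnegative square.
\<close>

lemma geodesic_distance_hyperbolic:
  fixes p q :: "real ^ 'k::finite option"
  assumes "r > 0" and p: "p \<in> hyperbolic_space r" and q: "q \<in> hyperbolic_space r"
  shows "- lorentz p q / r\<^sup>2 \<ge> 1"
    and "geodesic_distance lorentz (hyperbolic_space r) p q = r * arcosh (- lorentz p q / r\<^sup>2)"
proof -
  interpret space_form lorentz "hyperbolic_space r :: (real ^ 'k option) set" r "-1" cosh sinh
    by (rule space_form_hyperbolic) fact
  have range: "- lorentz p x / r\<^sup>2 \<in> {1..}" if x: "x \<in> hyperbolic_space r" for x
  proof -
    have "\<bar>spatial p x\<bar> < \<bar>p $ None\<bar> * \<bar>x $ None\<bar>" "p $ None > 0" "x $ None > 0"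
      using spatial_less_on_quadric[of r p x] p x assms by (auto simp: hyperbolic_space_def)
    then have neg: "lorentz p x < 0" by (simp add: lorentz_spatial)
    define w where "w = p + (lorentz p x / r\<^sup>2) *\<^sub>R x"
    have xp: "lorentz x p = lorentz p x" by (rule lorentz_commute)
    have "lorentz x w = 0"
      using quadric[OF x] \<open>r > 0\<close> by (simp add: w_def form_simps xp)
    then have "0 \<le> lorentz w w" by (rule tangent_nonneg[OF x])
    also have "lorentz w w = (lorentz p x)\<^sup>2 / r\<^sup>2 - r\<^sup>2"
      using quadric[OF x] quadric[OF p] \<open>r > 0\<close>
      by (simp add: w_def form_simps xp power2_eq_square field_simps)
    finally have "(r\<^sup>2)\<^sup>2 \<le> (- lorentz p x)\<^sup>2"
      using \<open>r > 0\<close> by (simp add: field_simps power2_eq_square)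
    then have "r\<^sup>2 \<le> - lorentz p x"
      by (rule power2_le_imp_le) (use neg in simp)
    then show ?thesis using \<open>r > 0\<close> by (simp add: field_simps)
  qed
  define \<sigma> where "\<sigma> = - lorentz p q / r\<^sup>2"
  have \<sigma>: "1 \<le> \<sigma>" using range[OF q] by (auto simp: \<sigma>_def)
  then show "- lorentz p q / r\<^sup>2 \<ge> 1" by (simp add: \<sigma>_def)
  show "geodesic_distance lorentz (hyperbolic_space r) p q = r * arcosh (- lorentz p q / r\<^sup>2)"
    unfolding \<sigma>_def[symmetric]
  proof (rule geodesic_distance_eqI[OF p q])
    show "lorentz p q = - 1 * r\<^sup>2 * cosh (arcosh \<sigma>)"
      using \<sigma> \<open>r > 0\<close> by (simp add: \<sigma>_def)
    show "0 \<le> arcosh \<sigma>" using \<sigma> by simp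
    fix \<gamma> assume \<gamma>: "\<gamma> \<in> connecting_curves lorentz (hyperbolic_space r) p q"
    have bound: "r * (arcosh (c * \<sigma>) - arcosh c) \<le> integral {0..1} (speed lorentz \<gamma>)" if c: "1 < c" for c
    proof -
      have "r * (arcosh (c * (lorentz p q / (- 1 * r\<^sup>2))) - arcosh (c * 1)) \<le> integral {0..1} (speed lorentz \<gamma>)"
      proof (rule length_lower_bound[OF p \<gamma>, where D = "{1..}"
            and h' = "\<lambda>x. c / sqrt ((c * x)\<^sup>2 - 1)"])
        fix x :: real assume x: "x \<in> {1..}"
        have "c * 1 \<le> c * x" using c x by (intro mult_left_mono) auto
        then have gt: "c * x > 1" using c by linarith
        have "((*) c has_real_derivative c) (at x)"
          by (rule DERIV_cmult_Id)
        from DERIV_chain2[OF arcosh_real_has_field_derivative[OF gt] this]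
        show "((\<lambda>x. arcosh (c * x)) has_real_derivative c / sqrt ((c * x)\<^sup>2 - 1)) (at x)"
          by simp
        have "1 \<le> c\<^sup>2" using c by simp
        then have "sqrt (c\<^sup>2 * (x\<^sup>2 - 1)) \<le> sqrt ((c * x)\<^sup>2 - 1)"
          by (simp add: algebra_simps)
        then have "c * sqrt (x\<^sup>2 - 1) \<le> sqrt ((c * x)\<^sup>2 - 1)"
          using c by (simp add: real_sqrt_mult)
        moreover have "1 < (c * x)\<^sup>2" using gt by simp
        ultimately show "\<bar>c / sqrt ((c * x)\<^sup>2 - 1)\<bar> * sqrt (- 1 * (1 - x\<^sup>2)) \<le> 1"
          using c by (simp add: abs_div)
      qed (use range in simp)
      then show ?thesis by (simp add: \<sigma>_def)
    qed
    have lim: "((\<lambda>c. r * (arcosh (c * \<sigma>) - arcosh c)) \<longlongrightarrow> r * (arcosh (1 * \<sigma>) - arcosh 1)) (at_right 1)"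
    proof -
      have near: "\<forall>\<^sub>F c in at_right (1::real). c \<in> {1<..<2}"
        by (rule eventually_at_rightI[of _ 2]) auto
      have "((\<lambda>c. arcosh (c * y)) \<longlongrightarrow> arcosh (1 * y)) (at_right 1)" if y: "1 \<le> y" for y :: real
      proof (rule continuous_on_tendsto_compose[OF continuous_on_arcosh[OF order.refl]])
        show "((\<lambda>c. c * y) \<longlongrightarrow> 1 * y) (at_right 1)" by (intro tendsto_intros)
        show "\<forall>\<^sub>F c in at_right 1. c * y \<in> {1..}"
          using near
        proof eventually_elim
          case (elim c)
          then have "1 * 1 \<le> c * y"
            using y by (intro mult_mono) auto
          then show ?case by auto
        qed
      qed (use y in auto)
      from this[of \<sigma>] this[of 1] show ?thesis
        using \<sigma> by (intro tendsto_mult tendsto_diff tendsto_const) auto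
    qed
    have "\<forall>\<^sub>F c in at_right 1. r * (arcosh (c * \<sigma>) - arcosh c) \<le> integral {0..1} (speed lorentz \<gamma>)"
      by (rule eventually_at_rightI[of _ 2]) (use bound in auto)
    from tendsto_upperbound[OF lim this]
    show "r * arcosh \<sigma> \<le> integral {0..1} (speed lorentz \<gamma>)" by simp
  qed
qed

lemma mem_geodesic_sphere_in_hyperbolic_space:
  fixes p :: "real ^ 'k::finite option"
  assumes "r > 0" "p \<in> hyperbolic_space r" "0 < z"
  shows "q \<in> geodesic_sphere lorentz (hyperbolic_space r) p z \<longleftrightarrow>
    q \<in> hyperbolic_space r \<and> lorentz p q = - 1 * r\<^sup>2 * cosh (z / r)"
proof (cases "q \<in> hyperbolic_space r")
  case True
  have z: "0 \<le> z / r" using assms by simp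
  note dist = geodesic_distance_hyperbolic[OF assms(1,2) True]
  have "r * arcosh (- lorentz p q / r\<^sup>2) = z \<longleftrightarrow> arcosh (- lorentz p q / r\<^sup>2) = z / r"
    using assms(1) by (auto simp: field_simps)
  also have "\<dots> \<longleftrightarrow> - lorentz p q / r\<^sup>2 = cosh (z / r)"
    using z dist(1) by (metis arcosh_cosh_real cosh_arcosh_real)
  also have "\<dots> \<longleftrightarrow> lorentz p q = - 1 * r\<^sup>2 * cosh (z / r)"
    using assms(1) by (auto simp: field_simps)
  finally show ?thesis
    using True dist(2) by (simp add: geodesic_sphere_def)
qed (simp add: geodesic_sphere_def)

section \<open>The characterization\<close>

lemma cot_rescale:
  fixes r z c :: real
  assumes "r > 0" "0 < z" "z < pi * r / 2" "c > 0"
  obtains z' where "0 < z'" "z' < pi * r / 2" "cot (z' / r) = cot (z / r) / c"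
proof -
  have zr: "0 < z / r" "z / r < pi / 2"
    using assms by (auto simp: field_simps)
  define y where "y = arctan (c * tan (z / r))"
  have "tan (z / r) > 0" using zr by (rule tan_gt_zero)
  with \<open>c > 0\<close> have y: "0 < y" "y < pi / 2" "tan y = c * tan (z / r)"
    using arctan_ubound[of "c * tan (z / r)"] by (auto simp: y_def tan_arctan)
  show ?thesis
  proof (rule that[of "r * y"])
    show "0 < r * y" "r * y < pi * r / 2"
      using y \<open>r > 0\<close> by (auto simp: field_simps)
    show "cot (r * y / r) = cot (z / r) / c"
      using y(3) \<open>r > 0\<close> by (simp add: cot_altdef field_simps)
  qed
qed

text \<open>
  The coefficients cannot all vanish, since \<open>cot (z / r) > 0\<close> below the radius of the equator; dividing
  by their Euclidean norm divides the cotangent by a positive number, which is again a cotangent.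
\<close>

lemma normalize_coefficients:
  fixes r z :: real and a :: "'m::finite \<Rightarrow> real"
  assumes "r > 0" "0 < z" "z < pi * r / 2" "I \<noteq> {}"
    and rel: "\<forall>s\<in>I. (\<Sum>i\<in>UNIV. a i * \<kappa> i s) + 1 / r * cot (z / r) = 0"
  obtains z' a' where "0 < z'" "z' < pi * r / 2" "(\<Sum>i\<in>UNIV. (a' i)\<^sup>2) = 1"
    "\<forall>s\<in>I. (\<Sum>i\<in>UNIV. a' i * \<kappa> i s) + 1 / r * cot (z' / r) = 0"
proof -
  define c where "c = sqrt (\<Sum>i\<in>UNIV. (a i)\<^sup>2)"
  have "cot (z / r) > 0"
    using assms by (intro cot_gt_zero) (auto simp: field_simps)
  then have "1 / r * cot (z / r) > 0" using \<open>r > 0\<close> by simp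
  have "c \<noteq> 0"
  proof
    assume "c = 0"
    then have "a i = 0" for i
      by (simp add: c_def sum_nonneg_eq_0_iff)
    moreover obtain s where "s \<in> I" using \<open>I \<noteq> {}\<close> by blast
    ultimately show False using bspec[OF rel, of s] \<open>1 / r * cot (z / r) > 0\<close> by auto
  qed
  then have c: "c > 0" "c\<^sup>2 = (\<Sum>i\<in>UNIV. (a i)\<^sup>2)"
    by (auto simp: c_def sum_nonneg less_le)
  obtain z' where z': "0 < z'" "z' < pi * r / 2" "cot (z' / r) = cot (z / r) / c"
    using cot_rescale[OF assms(1-3) c(1)] by blast
  show ?thesis
  proof (rule that[OF z'(1,2), of "\<lambda>i. a i / c"])
    show "(\<Sum>i\<in>UNIV. (a i / c)\<^sup>2) = 1"
      using c(1) by (simp add: power_divide flip: sum_divide_distrib c(2))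
    have "(\<Sum>i\<in>UNIV. a i / c * \<kappa> i s) + 1 / r * cot (z' / r)
        = ((\<Sum>i\<in>UNIV. a i * \<kappa> i s) + 1 / r * cot (z / r)) / c" for s
      by (simp add: z'(3) add_divide_distrib sum_divide_distrib)
    with rel show "\<forall>s\<in>I. (\<Sum>i\<in>UNIV. a i / c * \<kappa> i s) + 1 / r * cot (z' / r) = 0" by simp
  qed
qed

theorem theorem6p2p1:
  fixes r :: real
    and I :: "real set"
    and \<alpha> :: "real \<Rightarrow> real ^ 'm::finite option option"
    and n :: "'m \<Rightarrow> real \<Rightarrow> real ^ 'm option option"
    and \<kappa> :: "'m \<Rightarrow> real \<Rightarrow> real"
  assumes "r > 0"
  shows
    "(arclength_curve inner (sphere 0 r) I \<alpha> \<and> rotation_minimizing_frame inner I \<alpha> n \<kappa> \<longrightarrow>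
        ((\<exists>z\<^sub>0. 0 < z\<^sub>0 \<and> z\<^sub>0 < pi * r / 2 \<and>
            (\<exists>p\<in>sphere 0 r. \<alpha> ` I \<subseteq> geodesic_sphere inner (sphere 0 r) p z\<^sub>0)) \<longleftrightarrow>
         (\<exists>z\<^sub>0 a. 0 < z\<^sub>0 \<and> z\<^sub>0 < pi * r / 2 \<and>
            (\<forall>s\<in>I. (\<Sum>i\<in>UNIV. a i * \<kappa> i s) + 1 / r * cot (z\<^sub>0 / r) = 0))) \<and>
        (\<forall>z\<^sub>0. 0 < z\<^sub>0 \<and> z\<^sub>0 < pi * r / 2 \<longrightarrow>
          ((\<exists>p\<in>sphere 0 r. \<alpha> ` I \<subseteq> geodesic_sphere inner (sphere 0 r) p z\<^sub>0) \<longleftrightarrow>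
           (\<exists>a. (\<Sum>i\<in>UNIV. (a i)\<^sup>2) = 1 \<and>
              (\<forall>s\<in>I. (\<Sum>i\<in>UNIV. a i * \<kappa> i s) + 1 / r * cot (z\<^sub>0 / r) = 0)))))
     \<and>
     (arclength_curve lorentz (hyperbolic_space r) I \<alpha> \<and>
      rotation_minimizing_frame lorentz I \<alpha> n \<kappa> \<longrightarrow>
        ((\<exists>z\<^sub>0>0. \<exists>p\<in>hyperbolic_space r.
            \<alpha> ` I \<subseteq> geodesic_sphere lorentz (hyperbolic_space r) p z\<^sub>0) \<longleftrightarrow>
         (\<exists>z\<^sub>0>0. \<exists>a. (\<Sum>i\<in>UNIV. (a i)\<^sup>2) = 1 \<and>
            (\<forall>s\<in>I. (\<Sum>i\<in>UNIV. a i * \<kappa> i s) + 1 / r * coth (z\<^sub>0 / r) = 0))) \<and>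
        (\<forall>z\<^sub>0>0.
          ((\<exists>p\<in>hyperbolic_space r.
              \<alpha> ` I \<subseteq> geodesic_sphere lorentz (hyperbolic_space r) p z\<^sub>0) \<longleftrightarrow>
           (\<exists>a. (\<Sum>i\<in>UNIV. (a i)\<^sup>2) = 1 \<and>
              (\<forall>s\<in>I. (\<Sum>i\<in>UNIV. a i * \<kappa> i s) + 1 / r * coth (z\<^sub>0 / r) = 0)))))"
proof (intro conjI impI allI)
  have dimension: "DIM(real ^ 'm option option) = CARD('m) + 2" by simp
  {
    assume "arclength_curve inner (sphere 0 r) I \<alpha> \<and> rotation_minimizing_frame inner I \<alpha> n \<kappa>"
    then have curve: "arclength_curve inner (sphere 0 r) I \<alpha>"
      and frame: "rotation_minimizing_frame inner I \<alpha> n \<kappa>" by auto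
    interpret space_form inner "sphere (0 :: real ^ 'm option option) r" r 1 cos sin
      by (rule space_form_sphere[OF \<open>r > 0\<close>]) (simp add: dimension)
    have \<alpha>: "\<alpha> ` I \<subseteq> sphere 0 r" and I: "I \<noteq> {}"
      using curve by (auto simp: arclength_curve_def)
    have fixed: "(\<exists>p\<in>sphere 0 r. \<alpha> ` I \<subseteq> geodesic_sphere inner (sphere 0 r) p z) \<longleftrightarrow>
        (\<exists>a. (\<Sum>i\<in>UNIV. (a i)\<^sup>2) = 1 \<and> (\<forall>s\<in>I. (\<Sum>i\<in>UNIV. a i * \<kappa> i s) + 1 / r * cot (z / r) = 0))"
      if z: "0 < z" "z < pi * r / 2" for z
    proof -
      have "0 < z / r" "z / r < pi"
        using z \<open>r > 0\<close> pi_gt_zero by (auto simp: field_simps)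
      then have "sin (z / r) > 0" by (rule sin_gt_zero)
      note relation = spherical_iff_curvature_relation[OF curve frame dimension this]
      have "\<alpha> ` I \<subseteq> geodesic_sphere inner (sphere 0 r) p z \<longleftrightarrow>
          (\<forall>s\<in>I. inner p (\<alpha> s) = 1 * r\<^sup>2 * cos (z / r))" if "p \<in> sphere 0 r" for p
        using \<alpha> mem_geodesic_sphere_in_sphere[OF \<open>r > 0\<close> dim that z] by blast
      then show ?thesis
        unfolding cot_def using relation by (simp only: cong: bex_cong)
    qed
    show "(\<exists>z\<^sub>0. 0 < z\<^sub>0 \<and> z\<^sub>0 < pi * r / 2 \<and>
            (\<exists>p\<in>sphere 0 r. \<alpha> ` I \<subseteq> geodesic_sphere inner (sphere 0 r) p z\<^sub>0)) \<longleftrightarrow>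
         (\<exists>z\<^sub>0 a. 0 < z\<^sub>0 \<and> z\<^sub>0 < pi * r / 2 \<and>
            (\<forall>s\<in>I. (\<Sum>i\<in>UNIV. a i * \<kappa> i s) + 1 / r * cot (z\<^sub>0 / r) = 0))" (is "?spherical \<longleftrightarrow> ?relation")
    proof
      assume ?spherical
      then obtain z where "0 < z" "z < pi * r / 2"
        "\<exists>p\<in>sphere 0 r. \<alpha> ` I \<subseteq> geodesic_sphere inner (sphere 0 r) p z" by blast
      with fixed[of z] show ?relation by blast
    next
      assume ?relation
      then obtain z a where "0 < z" "z < pi * r / 2"
        and "\<forall>s\<in>I. (\<Sum>i\<in>UNIV. a i * \<kappa> i s) + 1 / r * cot (z / r) = 0" by blast
      from normalize_coefficients[OF \<open>r > 0\<close> this(1,2) I this(3)]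
      obtain z' a' where "0 < z'" "z' < pi * r / 2" "(\<Sum>i\<in>UNIV. (a' i)\<^sup>2) = 1"
        "\<forall>s\<in>I. (\<Sum>i\<in>UNIV. a' i * \<kappa> i s) + 1 / r * cot (z' / r) = 0" by blast
      with fixed[of z'] show ?spherical by blast
    qed
    show "(\<exists>p\<in>sphere 0 r. \<alpha> ` I \<subseteq> geodesic_sphere inner (sphere 0 r) p z\<^sub>0) \<longleftrightarrow>
        (\<exists>a. (\<Sum>i\<in>UNIV. (a i)\<^sup>2) = 1 \<and>
              (\<forall>s\<in>I. (\<Sum>i\<in>UNIV. a i * \<kappa> i s) + 1 / r * cot (z\<^sub>0 / r) = 0))"
      if "0 < z\<^sub>0 \<and> z\<^sub>0 < pi * r / 2" for z\<^sub>0
      by (rule fixed) (use that in auto)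
  next
    assume "arclength_curve lorentz (hyperbolic_space r) I \<alpha> \<and>
      rotation_minimizing_frame lorentz I \<alpha> n \<kappa>"
    then have curve: "arclength_curve lorentz (hyperbolic_space r) I \<alpha>"
      and frame: "rotation_minimizing_frame lorentz I \<alpha> n \<kappa>" by auto
    interpret space_form lorentz "hyperbolic_space r :: (real ^ 'm option option) set" r "-1" cosh sinh
      by (rule space_form_hyperbolic[OF \<open>r > 0\<close>])
    have \<alpha>: "\<alpha> ` I \<subseteq> hyperbolic_space r"
      using curve by (auto simp: arclength_curve_def)
    have fixed: "(\<exists>p\<in>hyperbolic_space r. \<alpha> ` I \<subseteq> geodesic_sphere lorentz (hyperbolic_space r) p z) \<longleftrightarrow>
        (\<exists>a. (\<Sum>i\<in>UNIV. (a i)\<^sup>2) = 1 \<and> (\<forall>s\<in>I. (\<Sum>i\<in>UNIV. a i * \<kappa> i s) + 1 / r * coth (z / r) = 0))"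
      if z: "0 < z" for z
    proof -
      have "sinh (z / r) > 0"
        using z \<open>r > 0\<close> by simp
      note relation = spherical_iff_curvature_relation[OF curve frame dimension this]
      have "\<alpha> ` I \<subseteq> geodesic_sphere lorentz (hyperbolic_space r) p z \<longleftrightarrow>
          (\<forall>s\<in>I. lorentz p (\<alpha> s) = - 1 * r\<^sup>2 * cosh (z / r))" if "p \<in> hyperbolic_space r" for p
        using \<alpha> mem_geodesic_sphere_in_hyperbolic_space[OF \<open>r > 0\<close> that z] by blast
      then show ?thesis
        unfolding coth_def using relation by (simp only: cong: bex_cong)
    qed
    show "(\<exists>z\<^sub>0>0. \<exists>p\<in>hyperbolic_space r.
            \<alpha> ` I \<subseteq> geodesic_sphere lorentz (hyperbolic_space r) p z\<^sub>0) \<longleftrightarrow>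
         (\<exists>z\<^sub>0>0. \<exists>a. (\<Sum>i\<in>UNIV. (a i)\<^sup>2) = 1 \<and>
            (\<forall>s\<in>I. (\<Sum>i\<in>UNIV. a i * \<kappa> i s) + 1 / r * coth (z\<^sub>0 / r) = 0))"
      by (rule ex_cong1, rule conj_cong[OF refl], rule fixed)
    show "(\<exists>p\<in>hyperbolic_space r.
              \<alpha> ` I \<subseteq> geodesic_sphere lorentz (hyperbolic_space r) p z\<^sub>0) \<longleftrightarrow>
           (\<exists>a. (\<Sum>i\<in>UNIV. (a i)\<^sup>2) = 1 \<and>
              (\<forall>s\<in>I. (\<Sum>i\<in>UNIV. a i * \<kappa> i s) + 1 / r * coth (z\<^sub>0 / r) = 0))"
      if "0 < z\<^sub>0" for z\<^sub>0
      using that by (rule fixed)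
  }
qed

end
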